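(* For all integers $n\geq 0$, $$B_{n}(y,t)=(1+yt)^{n}P_{n}^{(\mathrm{lpk},\mathrm{des})}\left(\frac{(1+y)^{2}t}{(y+t)(1+yt)},\frac{y+t}{1+yt}\right).$$ Equivalently, $$P_{n}^{(\mathrm{lpk},\mathrm{des})}(y,t)=\frac{B_{n}(u,v)}{(1+uv)^{n}},$$ where $$u=\frac{1+t^{2}-2yt-(1-t)\sqrt{(1+t)^{2}-4yt}}{2(1-y)t},\qquad v=\frac{(1+t)^{2}-2yt-(1+t)\sqrt{(1+t)^{2}-4yt}}{2yt}.$$
   Context: $\mathfrak{S}_n$ is the set of permutations $\pi=\pi_1\cdots\pi_n$ of $[n]=\{1,\dots,n\}$. For $\pi\in\mathfrak{S}_n$: $\mathrm{des}(\pi)$ is the number of $i\in[n-1]$ with $\pi_i>\pi_{i+1}$; $\mathrm{lpk}(\pi)$ is the number of left peaks, where $i\in[n-1]$ is a left peak if either $2\le i\le n-1$ and $\pi_{i-1}<\pi_i>\pi_{i+1}$, or $i=1$ and $\pi_1>\pi_2$. For $n\ge1$, $P_n^{(\mathrm{lpk},\mathrm{des})}(y,t)=\sum_{\pi\in\mathfrak{S}_n}y^{\mathrm{lpk}(\pi)}t^{\mathrm{des}(\pi)}$. $\mathfrak{B}_n$ is the set of signed permutations: permutations $\pi$ of $\{-n,\dots,-1,0,1,\dots,n\}$ with $\pi_{-i}=-\pi_i$ for all $i$ (so $\pi_0=0$), written $\pi=\pi_1\cdots\pi_n$. For $\pi\in\mathfrak{B}_n$, $\mathrm{des}_B(\pi)$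 is the number of $i\in\{0,1,\dots,n-1\}$ with $\pi_i>\pi_{i+1}$ (where $\pi_0=0$), and $\mathrm{neg}(\pi)$ is the number of $i\in[n]$ with $\pi_i<0$. For $n\ge1$, $B_n(y,t)=\sum_{\pi\in\mathfrak{B}_n}y^{\mathrm{neg}(\pi)}t^{\mathrm{des}_B(\pi)}$. The $0$th polynomials $P_0^{(\mathrm{lpk},\mathrm{des})}$ and $B_0$ are $1$. Here $y,t$ are indeterminates; the first identity is an identity of rational functions in $y,t$. In the second identity, $\sqrt{(1+t)^2-4yt}$ is the formal power series in $t$ over $\mathbb{Q}[y]$ with constant term $1$, so that $u$ and $v$ are formal power series in $t$ with coefficients in $\mathbb{Q}[y]$. *)

theory Defs
  imports
    "HOL-Computational_Algebra.Computational_Algebra"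
    "HOL-Combinatorics.Permutations"
begin

section \<open>The polynomials of permutation statistics\<close>

text \<open>A permutation of \<open>{1..n}\<close> is a function permuting \<open>{1..n}\<close> (and fixing everything else).\<close>

definition des :: "nat \<Rightarrow> (nat \<Rightarrow> nat) \<Rightarrow> nat" where
  "des n \<pi> = card {i \<in> {1..<n}. \<pi> i > \<pi> (i + 1)}"

definition lpk :: "nat \<Rightarrow> (nat \<Rightarrow> nat) \<Rightarrow> nat" where
  "lpk n \<pi> = card {i \<in> {1..<n}.
     (2 \<le> i \<and> \<pi> (i - 1) < \<pi> i \<and> \<pi> i > \<pi> (i + 1)) \<or> (i = 1 \<and> \<pi> 1 > \<pi> 2)}"

definition signed_perms :: "nat \<Rightarrow> (int \<Rightarrow> int) set" where
  "signed_perms n =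
     {\<pi>. \<pi> permutes {- int n..int n} \<and> (\<forall>i \<in> {- int n..int n}. \<pi> (- i) = - \<pi> i)}"

definition des_B :: "nat \<Rightarrow> (int \<Rightarrow> int) \<Rightarrow> nat" where
  "des_B n \<pi> = card {i \<in> {0..<int n}. \<pi> i > \<pi> (i + 1)}"

definition neg :: "nat \<Rightarrow> (int \<Rightarrow> int) \<Rightarrow> nat" where
  "neg n \<pi> = card {i \<in> {1..int n}. \<pi> i < 0}"

text \<open>The two bivariate polynomials have integer coefficients; they are given by their values at
  elements of an arbitrary commutative ring, so that the polynomials themselves are the values
  at indeterminates.\<close>

definition lpk_des_poly :: "nat \<Rightarrow> 'a::comm_ring_1 \<Rightarrow> 'a \<Rightarrow> 'a" where
  "lpk_des_poly n y t = (\<Sum>\<pi> | \<pi> permutes {1..n}. y ^ lpk n \<pi> * t ^ des n \<pi>)"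

definition B_poly :: "nat \<Rightarrow> 'a::comm_ring_1 \<Rightarrow> 'a \<Rightarrow> 'a" where
  "B_poly n y t = (\<Sum>\<pi> \<in> signed_perms n. y ^ neg n \<pi> * t ^ des_B n \<pi>)"

lemma lpk_des_poly_0: "lpk_des_poly 0 y t = 1"
  by (simp add: lpk_des_poly_def lpk_def des_def)

lemma B_poly_0: "B_poly 0 y t = 1"
proof -
  have "signed_perms 0 = {id}"
    by (auto simp: signed_perms_def permutes_sing)
  then show ?thesis
    by (simp add: B_poly_def neg_def des_B_def)
qed


section \<open>The field of rational functions in two indeterminates\<close>

text \<open>\<open>\<rat>(y,t)\<close> is the fraction field of \<open>\<rat>[y][t]\<close>.\<close>

definition y_rat :: "rat poly poly fract" where
  "y_rat = to_fract [:[:0, 1:]:]"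

definition t_rat :: "rat poly poly fract" where
  "t_rat = to_fract [:0, 1:]"


section \<open>Power series in \<open>t\<close> over \<open>\<rat>[y]\<close>\<close>

definition y_fps :: "rat poly fps" where
  "y_fps = fps_const [:0, 1:]"

definition sqrt_fps :: "rat poly fps" where
  "sqrt_fps = (THE s. s\<^sup>2 = (1 + fps_X)\<^sup>2 - 4 * y_fps * fps_X \<and> s $ 0 = 1)"

text \<open>The divisions in \<open>u\<close> and \<open>v\<close> are carried out in the field \<open>\<rat>(y)((t))\<close> of Laurent series,
  which contains \<open>\<rat>[y][[t]]\<close>; lemmas \<open>u_fls_power_series\<close> and \<open>v_fls_power_series\<close> below
  show that \<open>u\<close> and \<open>v\<close> lie in the latter.\<close>

definition of_series :: "rat poly fps \<Rightarrow> rat poly fract fls" where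
  "of_series f = fps_to_fls (Abs_fps (\<lambda>n. to_fract (f $ n)))"

definition y_fls :: "rat poly fract fls" where
  "y_fls = of_series y_fps"

definition t_fls :: "rat poly fract fls" where
  "t_fls = of_series fps_X"

definition sqrt_fls :: "rat poly fract fls" where
  "sqrt_fls = of_series sqrt_fps"

definition u_fls :: "rat poly fract fls" where
  "u_fls = (1 + t_fls\<^sup>2 - 2 * y_fls * t_fls - (1 - t_fls) * sqrt_fls) / (2 * (1 - y_fls) * t_fls)"

definition v_fls :: "rat poly fract fls" where
  "v_fls = ((1 + t_fls)\<^sup>2 - 2 * y_fls * t_fls - (1 + t_fls) * sqrt_fls) / (2 * y_fls * t_fls)"


subsection \<open>Well-definedness\<close>

lemma sqrt_fps_ex1:
  "\<exists>!s. s\<^sup>2 = (1 + fps_X)\<^sup>2 - 4 * y_fps * fps_X \<and> s $ 0 = 1"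
proof -
  define b :: "rat poly fps" where "b = Abs_fps (\<lambda>n. [:(1/2) gchoose n:])"
  define c :: "rat poly fps" where "c = (1 + fps_X)\<^sup>2 - 4 * y_fps * fps_X - 1"
  have c0: "c $ 0 = 0"
    by (simp add: c_def power2_eq_square)
  have bb: "b * b = 1 + fps_X"
  proof (rule fps_ext)
    fix n
    have "fps_binomial (1/2 + 1/2 :: rat) $ n = (fps_binomial (1/2) * fps_binomial (1/2)) $ n"
      by (simp only: fps_binomial_add_mult)
    then have "(\<Sum>i=0..n. ((1/2::rat) gchoose i) * ((1/2) gchoose (n - i))) = (1 + fps_X) $ n"
      by (simp add: fps_mult_nth fps_binomial_1 flip: fps_binomial_1)
    moreover have "(b * b) $ n = [:\<Sum>i=0..n. ((1/2::rat) gchoose i) * ((1/2) gchoose (n - i)):]"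
      by (simp add: fps_mult_nth b_def poly_eq_iff coeff_sum coeff_pCons mult.commute split: nat.splits)
    ultimately show "(b * b) $ n = (1 + fps_X) $ n"
      by (auto simp: fps_X_def pCons_one)
  qed
  define s where "s = b oo c"
  have "s\<^sup>2 = 1 + c"
    using fps_compose_mult_distrib[OF c0, of b b] c0
    by (simp add: bb s_def power2_eq_square fps_compose_add_distrib)
  then have s2: "s\<^sup>2 = (1 + fps_X)\<^sup>2 - 4 * y_fps * fps_X"
    by (simp add: c_def)
  have s0: "s $ 0 = 1"
    by (simp add: s_def fps_compose_nth b_def pCons_one)
  show ?thesis
  proof (rule ex1I[of _ s])
    show "s\<^sup>2 = (1 + fps_X)\<^sup>2 - 4 * y_fps * fps_X \<and> s $ 0 = 1"
      using s2 s0 by simp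
  next
    fix r :: "rat poly fps"
    assume r: "r\<^sup>2 = (1 + fps_X)\<^sup>2 - 4 * y_fps * fps_X \<and> r $ 0 = 1"
    then have "r\<^sup>2 = s\<^sup>2" using s2 by simp
    then have "r = s \<or> r = - s" by (simp add: power2_eq_iff)
    moreover have "r \<noteq> - s"
    proof
      assume "r = - s"
      then have "r $ 0 = - (s $ 0)" by simp
      then show False using r s0 by simp
    qed
    ultimately show "r = s" by simp
  qed
qed

lemma sqrt_fps_square: "sqrt_fps\<^sup>2 = (1 + fps_X)\<^sup>2 - 4 * y_fps * fps_X"
  and sqrt_fps_nth_0: "sqrt_fps $ 0 = 1"
  using theI'[OF sqrt_fps_ex1] unfolding sqrt_fps_def by auto

lemma of_series_add: "of_series (f + g) = of_series f + of_series g"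
proof -
  have "Abs_fps (\<lambda>n. to_fract ((f + g) $ n)) =
      Abs_fps (\<lambda>n. to_fract (f $ n)) + Abs_fps (\<lambda>n. to_fract (g $ n))"
    by (simp add: fps_eq_iff)
  then show ?thesis by (simp only: of_series_def fps_to_fls_plus)
qed

lemma of_series_diff: "of_series (f - g) = of_series f - of_series g"
proof -
  have "Abs_fps (\<lambda>n. to_fract ((f - g) $ n)) =
      Abs_fps (\<lambda>n. to_fract (f $ n)) - Abs_fps (\<lambda>n. to_fract (g $ n))"
    by (simp add: fps_eq_iff)
  then show ?thesis by (simp only: of_series_def fps_to_fls_minus)
qed

lemma to_fract_sum: "to_fract (sum f A) = (\<Sum>x\<in>A. to_fract (f x))"
  by (induction A rule: infinite_finite_induct) auto

lemma of_series_mult: "of_series (f * g) = of_series f * of_series g"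
  unfolding of_series_def
  by (subst fls_times_fps_to_fls[symmetric]) (simp add: fps_eq_iff fps_mult_nth to_fract_sum)

lemma of_series_1: "of_series 1 = 1"
proof -
  have "Abs_fps (\<lambda>n. to_fract (1 $ n :: rat poly)) = 1"
    by (simp add: fps_eq_iff)
  then show ?thesis by (simp add: of_series_def)
qed

lemma of_series_2: "of_series 2 = 2"
  using of_series_add[of 1 1] by (simp add: of_series_1)

lemma of_series_inject: "of_series f = of_series g \<longleftrightarrow> f = g"
  by (simp add: of_series_def fps_eq_iff)

lemma of_series_0: "of_series 0 = 0"
  using of_series_diff[of 0 0] by simp

definition eval_coeffs :: "rat \<Rightarrow> rat poly fps \<Rightarrow> rat fps" where
  "eval_coeffs a f = Abs_fps (\<lambda>n. poly (f $ n) a)"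

lemma eval_coeffs_simps:
  "eval_coeffs a (f + g) = eval_coeffs a f + eval_coeffs a g"
  "eval_coeffs a (f - g) = eval_coeffs a f - eval_coeffs a g"
  "eval_coeffs a (f * g) = eval_coeffs a f * eval_coeffs a g"
  "eval_coeffs a 1 = 1"
  "eval_coeffs a fps_X = fps_X"
  "eval_coeffs a y_fps = fps_const a"
  by (auto simp: eval_coeffs_def fps_eq_iff fps_mult_nth poly_sum fps_X_def y_fps_def)

lemma eval_coeffs_numeral:
  "eval_coeffs a 2 = 2" "eval_coeffs a 4 = 4"
proof -
  show *: "eval_coeffs a 2 = 2"
    using eval_coeffs_simps(1)[of a 1 1] by (simp add: eval_coeffs_simps(4))
  show "eval_coeffs a 4 = 4"
    using eval_coeffs_simps(1)[of a 2 2] by (simp add: *)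
qed

lemma eval_coeffs_sqrt:
  assumes "r\<^sup>2 = (1 + fps_X)\<^sup>2 - 4 * fps_const a * fps_X" "r $ 0 = 1"
  shows "eval_coeffs a sqrt_fps = r"
proof -
  let ?e = "eval_coeffs a sqrt_fps"
  have "?e * ?e = r * r"
    using arg_cong[OF sqrt_fps_square, of "eval_coeffs a"] assms(1)
    by (simp add: power2_eq_square eval_coeffs_simps eval_coeffs_numeral)
  then have "?e = r \<or> ?e = - r"
    by (simp add: square_eq_iff)
  moreover have "?e $ 0 = 1"
    by (simp add: eval_coeffs_def sqrt_fps_nth_0)
  ultimately show ?thesis using assms(2) by auto
qed

lemma divisible_power_series:
  assumes "N $ 0 = 0" "eval_coeffs a N = 0" "k \<noteq> 0"
  shows "\<exists>U. N = U * (fps_const (smult k [:- a, 1:]) * fps_X)"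
proof
  have dvd: "smult k [:- a, 1:] dvd N $ n" for n
  proof -
    have "poly (N $ n) a = 0"
      using arg_cong[OF assms(2), of "\<lambda>f. f $ n"] by (simp add: eval_coeffs_def)
    then show ?thesis
      using assms(3) by (simp only: poly_eq_0_iff_dvd smult_dvd_iff) simp
  qed
  show "N = Abs_fps (\<lambda>n. N $ (n + 1) div smult k [:- a, 1:]) * (fps_const (smult k [:- a, 1:]) * fps_X)"
    (is "N = ?U * (fps_const ?d * fps_X)")
  proof (rule fps_ext)
    fix n
    show "N $ n = (?U * (fps_const ?d * fps_X)) $ n"
    proof (cases n)
      case 0
      then show ?thesis using assms(1) by simp
    next
      case (Suc m)
      have "(?U * (fps_const ?d * fps_X)) $ n = (fps_X * (fps_const ?d * ?U)) $ n"
        by (simp only: mult_ac)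
      also have "\<dots> = ?d * (N $ n div ?d)"
        using Suc by (simp del: fps_const_mult_apply_left mult_smult_left)
      finally show ?thesis using dvd[of n] by (simp only: dvd_mult_div_cancel)
    qed
  qed
qed

lemma u_fls_power_series: "u_fls \<in> range of_series"
proof -
  let ?N = "1 + fps_X * fps_X - 2 * y_fps * fps_X - (1 - fps_X) * sqrt_fps"
  have "eval_coeffs 1 sqrt_fps = 1 - fps_X"
    by (rule eval_coeffs_sqrt) (simp_all add: power2_eq_square algebra_simps)
  then have "eval_coeffs 1 ?N = 1 + fps_X * fps_X - 2 * fps_X - (1 - fps_X) * (1 - fps_X)"
    by (simp only: eval_coeffs_simps eval_coeffs_numeral fps_const_1_eq_1 mult_1_right)
  then have "eval_coeffs 1 ?N = 0"
    by (simp add: algebra_simps)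
  moreover have "?N $ 0 = 0"
    by (simp add: sqrt_fps_nth_0)
  ultimately obtain U where "?N = U * (fps_const (smult (-2) [:- 1, 1:]) * fps_X)"
    using divisible_power_series[of ?N 1 "-2"] by auto
  moreover have d: "fps_const (smult (-2) [:- 1, 1:]) = 2 * (1 - y_fps)"
    by (simp add: y_fps_def numeral_fps_const flip: fps_const_1_eq_1) (simp add: numeral_poly)
  ultimately have eq: "?N = U * (2 * (1 - y_fps) * fps_X)"
    by simp
  have "y_fps $ 0 \<noteq> 1 $ 0"
    by (simp add: y_fps_def one_pCons)
  then have "2 * (1 - y_fps) * fps_X \<noteq> 0"
    by auto
  then have "2 * (1 - y_fls) * t_fls \<noteq> 0"
    using of_series_inject[of "2 * (1 - y_fps) * fps_X" 0]
    by (simp add: y_fls_def t_fls_def of_series_mult of_series_diff of_series_1 of_series_2 of_series_0)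
  moreover have "1 + t_fls\<^sup>2 - 2 * y_fls * t_fls - (1 - t_fls) * sqrt_fls
      = of_series U * (2 * (1 - y_fls) * t_fls)"
    using arg_cong[OF eq, of of_series]
    by (simp add: y_fls_def t_fls_def sqrt_fls_def of_series_mult of_series_diff of_series_add
        of_series_1 of_series_2 power2_eq_square)
  ultimately have "u_fls = of_series U"
    by (simp add: u_fls_def)
  then show ?thesis by simp
qed

lemma v_fls_power_series: "v_fls \<in> range of_series"
proof -
  let ?N = "(1 + fps_X) * (1 + fps_X) - 2 * y_fps * fps_X - (1 + fps_X) * sqrt_fps"
  have "eval_coeffs 0 sqrt_fps = 1 + fps_X"
    by (rule eval_coeffs_sqrt) (simp_all add: power2_eq_square algebra_simps)
  then have "eval_coeffs 0 ?N = 0"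
    by (simp add: eval_coeffs_simps eval_coeffs_numeral algebra_simps)
  moreover have "?N $ 0 = 0"
    by (simp add: sqrt_fps_nth_0)
  ultimately obtain U where "?N = U * (fps_const (smult 2 [:- 0, 1:]) * fps_X)"
    using divisible_power_series[of ?N 0 2] by auto
  moreover have d: "fps_const (smult 2 [:- 0, 1:]) = 2 * y_fps"
    by (simp add: y_fps_def numeral_fps_const) (simp add: numeral_poly)
  ultimately have eq: "?N = U * (2 * y_fps * fps_X)"
    by simp
  have "2 * y_fps * fps_X \<noteq> 0"
    by (simp flip: d)
  then have "2 * y_fls * t_fls \<noteq> 0"
    using of_series_inject[of "2 * y_fps * fps_X" 0]
    by (simp add: y_fls_def t_fls_def of_series_mult of_series_2 of_series_0)
  moreover have "(1 + t_fls)\<^sup>2 - 2 * y_fls * t_fls - (1 + t_fls) * sqrt_fls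
      = of_series U * (2 * y_fls * t_fls)"
    using arg_cong[OF eq, of of_series]
    by (simp add: y_fls_def t_fls_def sqrt_fls_def of_series_mult of_series_diff of_series_add
        of_series_1 of_series_2 power2_eq_square)
  ultimately have "v_fls = of_series U"
    by (simp add: v_fls_def)
  then show ?thesis by simp
qed

end

theory Submission
  imports Defs
begin

text \<open>
  A signed permutation is a permutation \<open>\<pi>\<close> together with the set \<open>S\<close> of positions carrying a
  minus sign. With \<open>\<pi>\<^sub>0 = 0\<close>, a pair of adjacent positions \<open>i, i + 1\<close> is a type B descent
  iff either \<open>\<pi>\<^sub>i < \<pi>\<^sub>i\<^sub>+\<^sub>1\<close> and \<open>i + 1 \<in> S\<close>, or \<open>\<pi>\<^sub>i > \<pi>\<^sub>i\<^sub>+\<^sub>1\<close> and \<open>i \<notin> S\<close>. Each such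
  condition involves the sign of a single position, so for fixed \<open>\<pi>\<close> the sum over \<open>S\<close> is a
  product over positions: left peaks contribute \<open>(1 + y) t\<close>, valleys (including a final descent)
  \<open>1 + y\<close>, double descents \<open>y + t\<close>, and double ascents \<open>1 + y t\<close>. There are as many valleys as left
  peaks, which gives the first identity over every commutative ring before dividing.

  For the second identity, with \<open>s\<close> the square root, \<open>u = (s - 1 + t) / (s + 1 - t)\<close> and
  \<open>v = (1 + t - s) / (1 + t + s)\<close>, from which one reads off that the substitution \<open>(u, v)\<close>
  inverts the one in the first identity.
\<close>

section \<open>Signed permutations as permutations with signs\<close>

text \<open>\<open>S\<close> is a set of positions, not of values. The factor \<open>sgn i\<close>
  extends the signed word to an odd function on all integers.\<close>

definition attach_signs :: "(nat \<Rightarrow> nat) \<Rightarrow> nat set \<Rightarrow> int \<Rightarrow> int" where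
  "attach_signs \<pi> S i = (if nat \<bar>i\<bar> \<in> S then - 1 else 1) * sgn i * int (\<pi> (nat \<bar>i\<bar>))"

lemma permutes_interval_fixes_0:
  assumes "\<pi> permutes {1..n::nat}"
  shows "\<pi> 0 = 0"
  using permutes_not_in[OF assms, of 0] by simp

lemma abs_attach_signs:
  assumes "\<pi> permutes {1..n}"
  shows "\<bar>attach_signs \<pi> S i\<bar> = int (\<pi> (nat \<bar>i\<bar>))"
  using permutes_interval_fixes_0[OF assms]
  by (cases "i = 0") (auto simp: attach_signs_def abs_mult)

lemma attach_signs_minus: "attach_signs \<pi> S (- i) = - attach_signs \<pi> S i"
  by (simp add: attach_signs_def)

lemma attach_signs_of_nat:
  assumes "\<pi> permutes {1..n}"
  shows "attach_signs \<pi> S (int j) = (if j \<in> S then - int (\<pi> j) else int (\<pi> j))"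
  using permutes_interval_fixes_0[OF assms]
  by (cases "j = 0") (auto simp: attach_signs_def)

lemma attach_signs_in_signed_perms:
  assumes \<pi>: "\<pi> permutes {1..n}" and S: "S \<subseteq> {1..n}"
  shows "attach_signs \<pi> S \<in> signed_perms n"
proof -
  note z = permutes_interval_fixes_0[OF \<pi>]
  have "attach_signs \<pi> S permutes {- int n..int n}"
  proof (rule inj_imp_permutes)
    show "inj_on (attach_signs \<pi> S) {- int n..int n}"
    proof (rule inj_onI)
      fix a b assume e: "attach_signs \<pi> S a = attach_signs \<pi> S b"
      then have "\<pi> (nat \<bar>a\<bar>) = \<pi> (nat \<bar>b\<bar>)"
        using abs_attach_signs[OF \<pi>, of S a] abs_attach_signs[OF \<pi>, of S b] by simp
      then have ab: "nat \<bar>a\<bar> = nat \<bar>b\<bar>"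
        using permutes_inj[OF \<pi>] by (simp add: inj_eq)
      show "a = b"
      proof (cases "a = 0")
        case False
        \<comment> \<open>Equal absolute positions get the same sign from \<open>S\<close> and the
          same nonzero value, so only \<open>sgn\<close> can still distinguish \<open>a\<close> from
          \<open>b\<close>.\<close>
        then have "\<pi> (nat \<bar>a\<bar>) \<noteq> 0"
          using permutes_inj[OF \<pi>] z by (metis inj_eq nat_0_iff not_le zero_less_abs_iff)
        with e ab False have "sgn a = sgn b"
          by (simp add: attach_signs_def split: if_splits)
        with ab show ?thesis
          by (simp add: sgn_if split: if_splits)
      qed (use ab in simp)
    qed
  next
    fix i assume "i \<in> {- int n..int n}"
    then have "nat \<bar>i\<bar> \<le> n" by auto
    then have "\<pi> (nat \<bar>i\<bar>) \<le> n"
      using permutes_in_image[OF \<pi>, of "nat \<bar>i\<bar>"] z by (cases "nat \<bar>i\<bar> = 0") auto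
    then show "attach_signs \<pi> S i \<in> {- int n..int n}"
      using abs_attach_signs[OF \<pi>, of S i] by auto
  next
    fix i assume "i \<notin> {- int n..int n}"
    then have "nat \<bar>i\<bar> \<notin> {1..n}" by auto
    then have "nat \<bar>i\<bar> \<notin> S" "\<pi> (nat \<bar>i\<bar>) = nat \<bar>i\<bar>"
      using S permutes_not_in[OF \<pi>] by auto
    then show "attach_signs \<pi> S i = i"
      by (simp add: attach_signs_def sgn_mult_abs)
  qed simp
  then show ?thesis
    by (simp add: signed_perms_def attach_signs_minus)
qed

text \<open>Outside the interval \<open>\<sigma>\<close> is the identity, which is odd as
  well.\<close>

lemma signed_perm_minus:
  assumes "\<sigma> \<in> signed_perms n"
  shows "\<sigma> (- i) = - \<sigma> i"
proof (cases "i \<in> {- int n..int n}")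
  case False
  moreover from this have "- i \<notin> {- int n..int n}" by auto
  moreover have "\<sigma> permutes {- int n..int n}"
    using assms by (simp add: signed_perms_def)
  ultimately show ?thesis
    by (metis permutes_not_in)
qed (use assms in \<open>auto simp: signed_perms_def\<close>)

lemma abs_signed_perm_permutes:
  assumes \<sigma>: "\<sigma> \<in> signed_perms n"
  shows "(\<lambda>j. nat \<bar>\<sigma> (int j)\<bar>) permutes {1..n}"
proof (rule inj_imp_permutes)
  have p: "\<sigma> permutes {- int n..int n}"
    using \<sigma> by (simp add: signed_perms_def)
  have z: "\<sigma> 0 = 0"
    using signed_perm_minus[OF \<sigma>, of 0] by simp
  show "inj_on (\<lambda>j. nat \<bar>\<sigma> (int j)\<bar>) {1..n}"
  proof (rule inj_onI)
    fix a b assume "a \<in> {1..n}" "b \<in> {1..n}" and "nat \<bar>\<sigma> (int a)\<bar> = nat \<bar>\<sigma> (int b)\<bar>"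
    \<comment> \<open>By oddness a sign change of the value moves to the argument;
      \<open>a = - b\<close> is then impossible for positive positions.\<close>
    then have "\<sigma> (int a) = \<sigma> (int b) \<or> \<sigma> (int a) = \<sigma> (- int b)"
      by (auto simp: signed_perm_minus[OF \<sigma>] abs_eq_iff)
    then show "a = b"
      using permutes_inj[OF p] by (auto simp: inj_eq)
  qed
  show "nat \<bar>\<sigma> (int j)\<bar> \<in> {1..n}" if "j \<in> {1..n}" for j
  proof -
    have "\<sigma> (int j) \<in> {- int n..int n}"
      using that permutes_in_image[OF p] by auto
    moreover have "\<sigma> (int j) \<noteq> \<sigma> 0"
      using that permutes_inj[OF p] by (simp add: inj_eq)
    ultimately show ?thesis using z by auto
  qed
  show "nat \<bar>\<sigma> (int j)\<bar> = j" if "j \<notin> {1..n}" for j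
  proof (cases "j = 0")
    case False
    then show ?thesis
      using that permutes_not_in[OF p, of "int j"] by auto
  qed (simp add: z)
qed simp

lemma attach_signs_decompose:
  assumes \<sigma>: "\<sigma> \<in> signed_perms n"
  shows "attach_signs (\<lambda>j. nat \<bar>\<sigma> (int j)\<bar>) {j \<in> {1..n}. \<sigma> (int j) < 0} = \<sigma>"
    (is "attach_signs ?p ?S = \<sigma>")
proof
  fix i
  have p: "\<sigma> permutes {- int n..int n}"
    using \<sigma> by (simp add: signed_perms_def)
  have z: "\<sigma> 0 = 0"
    using signed_perm_minus[OF \<sigma>, of 0] by simp
  note of_nat = attach_signs_of_nat[OF abs_signed_perm_permutes[OF \<sigma>]]
  have nat: "attach_signs ?p ?S (int j) = \<sigma> (int j)" for j
  proof (cases "j \<in> {1..n}")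
    case False
    then have "\<sigma> (int j) = int j"
      using z permutes_not_in[OF p, of "int j"] by (cases "j = 0") auto
    with False show ?thesis
      by (auto simp: of_nat)
  qed (auto simp: of_nat)
  then show "attach_signs ?p ?S i = \<sigma> i"
    by (cases i rule: int_cases2) (simp_all add: attach_signs_minus signed_perm_minus[OF \<sigma>])
qed

lemma attach_signs_neg_iff:
  assumes "\<pi> permutes {1..n}" and "j \<in> {1..n}"
  shows "attach_signs \<pi> S (int j) < 0 \<longleftrightarrow> j \<in> S"
  using assms(2) permutes_in_image[OF assms(1), of j] by (simp add: attach_signs_of_nat[OF assms(1)])

lemma neg_attach_signs:
  assumes "\<pi> permutes {1..n}" and "S \<subseteq> {1..n}"
  shows "{j \<in> {1..n}. attach_signs \<pi> S (int j) < 0} = S"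
  using assms attach_signs_neg_iff by blast

text \<open>Taking absolute values and recording the negative positions inverts
  \<open>attach_signs\<close>, so the sum can be reindexed by pairs.\<close>

lemma sum_signed_perms:
  "(\<Sum>\<sigma>\<in>signed_perms n. g \<sigma>) =
    (\<Sum>\<pi> | \<pi> permutes {1..n}. \<Sum>S\<in>Pow {1..n}. g (attach_signs \<pi> S))"
proof -
  have "(\<Sum>\<sigma>\<in>signed_perms n. g \<sigma>) =
      (\<Sum>(\<pi>, S) \<in> {\<pi>. \<pi> permutes {1..n}} \<times> Pow {1..n}. g (attach_signs \<pi> S))"
    by (rule sum.reindex_bij_witness
        [where j = "\<lambda>\<sigma>. (\<lambda>j. nat \<bar>\<sigma> (int j)\<bar>, {j \<in> {1..n}. \<sigma> (int j) < 0})"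
          and i = "\<lambda>(\<pi>, S). attach_signs \<pi> S"])
      (use abs_signed_perm_permutes in \<open>auto simp: attach_signs_decompose
        attach_signs_in_signed_perms attach_signs_neg_iff abs_attach_signs subset_iff
        simp del: atLeastAtMost_iff One_nat_def\<close>)
  then show ?thesis
    by (simp add: sum.cartesian_product finite_permutations)
qed

lemma Collect_nonneg_eq_int_image:
  assumes "\<And>i. i \<in> X \<Longrightarrow> 0 \<le> i"
  shows "{i \<in> X. P i} = int ` {j. int j \<in> X \<and> P (int j)}"
  using assms by (auto simp: image_iff) (metis nonneg_int_cases)

lemma neg_attach_signs_card:
  assumes "\<pi> permutes {1..n}" and "S \<subseteq> {1..n}"
  shows "neg n (attach_signs \<pi> S) = card S"
proof -
  have "{i \<in> {1..int n}. attach_signs \<pi> S i < 0} =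
      int ` {j \<in> {1..n}. attach_signs \<pi> S (int j) < 0}"
    by (subst Collect_nonneg_eq_int_image) auto
  then show ?thesis
    by (simp only: neg_def neg_attach_signs[OF assms]) (simp add: card_image)
qed


section \<open>The sum over all choices of signs\<close>

text \<open>Here and in \<open>descents_out\<close> an adjacent pair is indexed by the position of
  its larger entry, whose sign alone decides whether the pair is a type B descent.\<close>

definition ascents_in :: "nat \<Rightarrow> (nat \<Rightarrow> nat) \<Rightarrow> nat set" where
  "ascents_in n \<pi> = {j \<in> {1..n}. \<pi> (j - 1) < \<pi> j}"

definition descents_out :: "nat \<Rightarrow> (nat \<Rightarrow> nat) \<Rightarrow> nat set" where
  "descents_out n \<pi> = {j \<in> {1..<n}. \<pi> j > \<pi> (j + 1)}"

lemma des_B_attach_signs: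
  assumes \<pi>: "\<pi> permutes {1..n}" and S: "S \<subseteq> {1..n}"
  shows "des_B n (attach_signs \<pi> S) = card (ascents_in n \<pi> \<inter> S) + card (descents_out n \<pi> - S)"
proof -
  let ?\<sigma> = "attach_signs \<pi> S"
  let ?A = "ascents_in n \<pi> \<inter> S" and ?D = "descents_out n \<pi> - S"
  note z = permutes_interval_fixes_0[OF \<pi>]
  have ne: "\<pi> j \<noteq> \<pi> (Suc j)" for j
    using permutes_inj[OF \<pi>] by (simp add: inj_eq)
  have iff: "?\<sigma> (int j) > ?\<sigma> (int (Suc j)) \<longleftrightarrow>
      \<pi> j < \<pi> (Suc j) \<and> Suc j \<in> S \<or> \<pi> j > \<pi> (Suc j) \<and> j \<notin> S" for j
    using ne[of j] by (auto simp: attach_signs_of_nat[OF \<pi>] simp del: of_nat_Suc)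
  have "{i \<in> {0..<int n}. ?\<sigma> i > ?\<sigma> (i + 1)} =
      int ` {j \<in> {0..<n}. ?\<sigma> (int j) > ?\<sigma> (int (Suc j))}"
    by (subst Collect_nonneg_eq_int_image) (auto simp: add.commute)
  \<comment> \<open>Type B descents are indexed by left ends, hence the shift for ascents. As
    \<open>\<pi> 0 = 0\<close>, the pair at 0 is never a descent of \<open>\<pi>\<close>, so
    \<open>?D\<close> may start at 1.\<close>
  also have "{j \<in> {0..<n}. ?\<sigma> (int j) > ?\<sigma> (int (Suc j))} = {j. Suc j \<in> ?A} \<union> ?D"
  proof -
    have "j \<ge> 1" if "\<pi> j > \<pi> (Suc j)" for j
      using that z by (cases j) auto
    then show ?thesis
      unfolding iff ascents_in_def descents_out_def by auto
  qed
  finally have "des_B n ?\<sigma> = card ({j. Suc j \<in> ?A} \<union> ?D)"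
    unfolding des_B_def by (simp add: card_image)
  also have "\<dots> = card {j. Suc j \<in> ?A} + card ?D"
    by (rule card_Un_disjoint) (auto simp: ascents_in_def descents_out_def
        intro: finite_subset[of _ "{..n}"])
  also have "card {j. Suc j \<in> ?A} = card ?A"
    by (rule bij_betw_same_card[of Suc])
      (force simp: bij_betw_def ascents_in_def image_iff gr0_conv_Suc Suc_le_eq)
  finally show ?thesis .
qed

lemma sum_Pow_two_statistics:
  fixes y t :: "'a::comm_ring_1"
  assumes U: "finite U" and A: "A \<subseteq> U" and D: "D \<subseteq> U"
  shows "(\<Sum>S\<in>Pow U. y ^ card S * t ^ (card (A \<inter> S) + card (D - S))) =
    ((1 + y) * t) ^ card (A \<inter> D) * (1 + y * t) ^ card (A - D) *
    (y + t) ^ card (D - A) * (1 + y) ^ card (U - (A \<union> D))"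
proof -
  \<comment> \<open>\<open>f j\<close> is the weight of position \<open>j\<close> when negative,
    \<open>g j\<close> when positive; the sum over all \<open>S\<close> expands the product of
    \<open>f j + g j\<close>, which is constant on each of the four classes cut out by
    \<open>A\<close> and \<open>D\<close>.\<close>
  define f where "f j = y * (if j \<in> A then t else 1)" for j
  define g where "g j = (if j \<in> D then t else 1)" for j
  have fin: "finite X" if "X \<subseteq> U" for X
    using that U finite_subset by blast
  have "y ^ card S * t ^ (card (A \<inter> S) + card (D - S)) = prod f S * prod g (U - S)"
    if "S \<subseteq> U" for S
  proof -
    have "(U - S) \<inter> D = D - S" using D by auto
    then have "prod g (U - S) = t ^ card (D - S)"
      using U by (simp add: g_def flip: prod.inter_restrict)
    moreover have "prod f S = y ^ card S * t ^ card (A \<inter> S)"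
      using fin[OF that] by (simp add: f_def prod.distrib Int_commute flip: prod.inter_restrict)
    ultimately show ?thesis by (simp add: power_add mult_ac)
  qed
  then have "(\<Sum>S\<in>Pow U. y ^ card S * t ^ (card (A \<inter> S) + card (D - S))) = (\<Prod>j\<in>U. f j + g j)"
    by (simp add: prod_add[OF U])
  also have "(\<Prod>j\<in>U. f j + g j) =
      (\<Prod>j\<in>(A \<inter> D) \<union> ((A - D) \<union> ((D - A) \<union> (U - (A \<union> D)))). f j + g j)"
    by (rule prod.cong) (use A D in auto)
  also have "\<dots> = (\<Prod>j\<in>A \<inter> D. f j + g j) *
      ((\<Prod>j\<in>A - D. f j + g j) * ((\<Prod>j\<in>D - A. f j + g j) * (\<Prod>j\<in>U - (A \<union> D). f j + g j)))"
    using U fin[OF A] fin[OF D] by (subst prod.union_disjoint; (simp; blast)?)+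
  also have "(\<Prod>j\<in>A \<inter> D. f j + g j) = ((1 + y) * t) ^ card (A \<inter> D)"
    by (simp add: f_def g_def algebra_simps)
  also have "(\<Prod>j\<in>A - D. f j + g j) = (1 + y * t) ^ card (A - D)"
    by (simp add: f_def g_def add.commute)
  also have "(\<Prod>j\<in>D - A. f j + g j) = (y + t) ^ card (D - A)"
    by (simp add: f_def g_def)
  also have "(\<Prod>j\<in>U - (A \<union> D). f j + g j) = (1 + y) ^ card (U - (A \<union> D))"
    by (simp add: f_def g_def add.commute)
  finally show ?thesis by (simp only: mult.assoc)
qed

section \<open>Sizes of the four classes of positions\<close>

lemma card_descents_out: "card (descents_out n \<pi>) = des n \<pi>"
  by (simp add: descents_out_def des_def)

text \<open>With \<open>\<pi> 0 = 0\<close> the entry at position 1 is always reached by an ascent,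
  so the clause \<open>i = 1\<close> of \<open>lpk\<close> is an ordinary peak condition.\<close>

lemma card_ascents_in_Int_descents_out:
  assumes "\<pi> permutes {1..n}"
  shows "card (ascents_in n \<pi> \<inter> descents_out n \<pi>) = lpk n \<pi>"
proof -
  have "0 < \<pi> 1"
    using permutes_interval_fixes_0[OF assms] permutes_inj[OF assms]
    by (metis inj_eq not_gr_zero zero_neq_one)
  then have "ascents_in n \<pi> \<inter> descents_out n \<pi> = {i \<in> {1..<n}.
      (2 \<le> i \<and> \<pi> (i - 1) < \<pi> i \<and> \<pi> i > \<pi> (i + 1)) \<or> (i = 1 \<and> \<pi> 1 > \<pi> 2)}"
    using permutes_interval_fixes_0[OF assms]
    by (intro set_eqI, case_tac "x = 1")
      (auto simp: ascents_in_def descents_out_def numeral_2_eq_2)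
  then show ?thesis
    by (simp only: lpk_def)
qed

lemma card_ascents_in:
  assumes "\<pi> permutes {1..n}"
  shows "card (ascents_in n \<pi>) + des n \<pi> = n"
proof -
  have ne: "\<pi> j \<noteq> \<pi> (Suc j)" for j
    using permutes_inj[OF assms] by (simp add: inj_eq)
  have sub: "ascents_in n \<pi> \<subseteq> {1..n}"
    by (auto simp: ascents_in_def)
  \<comment> \<open>A position not reached by an ascent is reached by a descent from its
    predecessor.\<close>
  have "{1..n} - ascents_in n \<pi> = Suc ` descents_out n \<pi>"
  proof (rule set_eqI)
    fix j
    show "j \<in> {1..n} - ascents_in n \<pi> \<longleftrightarrow> j \<in> Suc ` descents_out n \<pi>"
    proof (cases j)
      case (Suc i)
      then show ?thesis
        using ne[of i] permutes_interval_fixes_0[OF assms]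
        by (cases i) (auto simp: ascents_in_def descents_out_def inj_image_mem_iff)
    qed simp
  qed
  then have "card ({1..n} - ascents_in n \<pi>) = des n \<pi>"
    by (simp add: card_image card_descents_out)
  moreover have "card ({1..n} - ascents_in n \<pi>) = n - card (ascents_in n \<pi>)"
    using sub by (simp add: card_Diff_subset finite_subset)
  moreover have "card (ascents_in n \<pi>) \<le> n"
    using card_mono[OF _ sub] by simp
  ultimately show ?thesis by simp
qed

lemma lpk_le_des: "lpk n \<pi> \<le> des n \<pi>"
  unfolding lpk_def des_def by (rule card_mono) (auto simp: numeral_2_eq_2)

text \<open>Left peaks are among the \<open>n - des n \<pi>\<close> positions reached by an ascent.
  Together with \<open>lpk_le_des\<close> this makes the truncated subtractions in later exponents
  exact.\<close>

lemma lpk_plus_des_le: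
  assumes "\<pi> permutes {1..n}"
  shows "lpk n \<pi> + des n \<pi> \<le> n"
proof -
  have "lpk n \<pi> \<le> card (ascents_in n \<pi>)"
    unfolding card_ascents_in_Int_descents_out[OF assms, symmetric]
    by (rule card_mono) (auto simp: ascents_in_def)
  then show ?thesis
    using card_ascents_in[OF assms] by simp
qed

lemma sum_signs:
  fixes y t :: "'a::comm_ring_1"
  assumes \<pi>: "\<pi> permutes {1..n}"
  shows "(\<Sum>S\<in>Pow {1..n}. y ^ neg n (attach_signs \<pi> S) * t ^ des_B n (attach_signs \<pi> S)) =
    ((1 + y)\<^sup>2 * t) ^ lpk n \<pi> * (y + t) ^ (des n \<pi> - lpk n \<pi>) *
    (1 + y * t) ^ (n - lpk n \<pi> - des n \<pi>)"
proof -
  let ?A = "ascents_in n \<pi>" and ?D = "descents_out n \<pi>"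
  have A: "?A \<subseteq> {1..n}" and D: "?D \<subseteq> {1..n}"
    by (auto simp: ascents_in_def descents_out_def)
  have fin: "finite ?A" "finite ?D"
    by (simp_all add: ascents_in_def descents_out_def)
  have AD: "card (?A \<inter> ?D) = lpk n \<pi>"
    by (rule card_ascents_in_Int_descents_out[OF \<pi>])
  have A_D: "card (?A - ?D) = n - lpk n \<pi> - des n \<pi>"
    using card_Diff_subset_Int[of ?A ?D] fin AD card_ascents_in[OF \<pi>] by simp
  have D_A: "card (?D - ?A) = des n \<pi> - lpk n \<pi>"
    using card_Diff_subset_Int[of ?D ?A] fin AD card_descents_out[of n \<pi>]
    by (simp add: Int_commute)
  \<comment> \<open>Inclusion-exclusion with \<open>card ?A + card ?D = n\<close>: the positions
    outside the union, the valleys, are as many as the left peaks, and their factors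
    \<open>1 + y\<close> complete the square.\<close>
  have "card (?A \<union> ?D) = n - lpk n \<pi>"
    using card_Un_Int[OF fin] AD card_ascents_in[OF \<pi>] card_descents_out[of n \<pi>] by simp
  then have rest: "card ({1..n} - (?A \<union> ?D)) = lpk n \<pi>"
    using A D fin lpk_plus_des_le[OF \<pi>] by (subst card_Diff_subset) auto
  have "(\<Sum>S\<in>Pow {1..n}. y ^ neg n (attach_signs \<pi> S) * t ^ des_B n (attach_signs \<pi> S)) =
      (\<Sum>S\<in>Pow {1..n}. y ^ card S * t ^ (card (?A \<inter> S) + card (?D - S)))"
    by (rule sum.cong) (simp_all add: neg_attach_signs_card[OF \<pi>] des_B_attach_signs[OF \<pi>])
  also have "\<dots> = ((1 + y) * t) ^ lpk n \<pi> * (1 + y * t) ^ (n - lpk n \<pi> - des n \<pi>) *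
      (y + t) ^ (des n \<pi> - lpk n \<pi>) * (1 + y) ^ lpk n \<pi>"
    using sum_Pow_two_statistics[OF _ A D, of y t] by (simp only: AD A_D D_A rest finite_atLeastAtMost)
  finally show ?thesis
    by (simp add: power2_eq_square power_mult_distrib mult_ac)
qed

lemma B_poly_expansion:
  fixes y t :: "'a::comm_ring_1"
  shows "B_poly n y t = (\<Sum>\<pi> | \<pi> permutes {1..n}.
    ((1 + y)\<^sup>2 * t) ^ lpk n \<pi> * (y + t) ^ (des n \<pi> - lpk n \<pi>) *
    (1 + y * t) ^ (n - lpk n \<pi> - des n \<pi>))"
  unfolding B_poly_def sum_signed_perms by (rule sum.cong[OF refl]) (rule sum_signs, simp only: mem_Collect_eq)

text \<open>The arbitrary field allows use both for rational functions and at \<open>u_fls\<close>,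
  \<open>v_fls\<close> in Laurent series.\<close>

theorem B_poly_eq_lpk_des_poly:
  fixes y t :: "'a::field"
  assumes yt: "y + t \<noteq> 0" and one: "1 + y * t \<noteq> 0"
  shows "B_poly n y t = (1 + y * t) ^ n *
    lpk_des_poly n ((1 + y)\<^sup>2 * t / ((y + t) * (1 + y * t))) ((y + t) / (1 + y * t))"
  unfolding B_poly_expansion lpk_des_poly_def sum_distrib_left
proof (rule sum.cong)
  fix \<pi> assume "\<pi> \<in> {\<pi>. \<pi> permutes {1..n}}"
  then obtain d m where d: "des n \<pi> = lpk n \<pi> + d" and m: "n = lpk n \<pi> + des n \<pi> + m"
    using lpk_le_des lpk_plus_des_le le_Suc_ex by (metis mem_Collect_eq)
  define l where "l = lpk n \<pi>"
  have n: "n = l + (l + d) + m"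
    using d m by (simp add: l_def)
  \<comment> \<open>The two fractions absorb \<open>l\<close> and \<open>l + d\<close> factors
    \<open>a\<close>, leaving \<open>a ^ m\<close>; of the \<open>l + d\<close> factors
    \<open>b\<close>, \<open>l\<close> cancel.\<close>
  have "c ^ l * b ^ d * a ^ m = a ^ (l + (l + d) + m) * ((c / (b * a)) ^ l * (b / a) ^ (l + d))"
    if "a \<noteq> 0" "b \<noteq> 0" for a b c :: 'a
    using that by (simp add: power_add power_divide power_mult_distrib field_simps)
  note this[OF one yt, of "(1 + y)\<^sup>2 * t"]
  then show "((1 + y)\<^sup>2 * t) ^ lpk n \<pi> * (y + t) ^ (des n \<pi> - lpk n \<pi>) *
      (1 + y * t) ^ (n - lpk n \<pi> - des n \<pi>) =
    (1 + y * t) ^ n * (((1 + y)\<^sup>2 * t / ((y + t) * (1 + y * t))) ^ lpk n \<pi> *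
      ((y + t) / (1 + y * t)) ^ des n \<pi>)"
    unfolding l_def[symmetric] d[folded l_def] using n by simp
qed simp


section \<open>Inverting the substitution\<close>

lemma inverse_substitution:
  fixes s t y :: "'a::field_char_0"
  assumes s2: "s\<^sup>2 = (1 + t)\<^sup>2 - 4 * y * t"
    and "s \<noteq> 0" "t \<noteq> 0" "y \<noteq> 0" "y \<noteq> 1"
  defines "u \<equiv> (1 + t\<^sup>2 - 2 * y * t - (1 - t) * s) / (2 * (1 - y) * t)"
    and "v \<equiv> ((1 + t)\<^sup>2 - 2 * y * t - (1 + t) * s) / (2 * y * t)"
  shows "u + v \<noteq> 0" and "1 + u * v \<noteq> 0" and "(u + v) / (1 + u * v) = t"
    and "(1 + u)\<^sup>2 * v / ((u + v) * (1 + u * v)) = y"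
proof -
  \<comment> \<open>Conjugates of the numerators \<open>s - 1 + t\<close> and
    \<open>1 + t - s\<close>: by \<open>s2\<close> the products lose \<open>s\<close> and are
    nonzero, so \<open>p\<close> and \<open>q\<close> are nonzero too.\<close>
  define p q where "p = s + 1 - t" and "q = 1 + t + s"
  have p: "(s - 1 + t) * p = 4 * (1 - y) * t" and q: "(1 + t - s) * q = 4 * y * t"
    using s2 unfolding p_def q_def by algebra+
  with assms have p0: "p \<noteq> 0" and q0: "q \<noteq> 0"
    by auto
  have u: "u = (s - 1 + t) / p"
  proof -
    have "(1 + t\<^sup>2 - 2 * y * t - (1 - t) * s) * p = (s - 1 + t) * (2 * (1 - y) * t)"
      using s2 unfolding p_def by algebra
    then show ?thesis
      using p0 assms by (simp add: u_def frac_eq_eq)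
  qed
  have v: "v = (1 + t - s) / q"
  proof -
    have "((1 + t)\<^sup>2 - 2 * y * t - (1 + t) * s) * q = (1 + t - s) * (2 * y * t)"
      using s2 unfolding q_def by algebra
    then show ?thesis
      using q0 assms by (simp add: v_def frac_eq_eq)
  qed
  have uv1: "1 + u * v = 4 * s / (p * q)"
  proof -
    have "p * q + (s - 1 + t) * (1 + t - s) = 4 * s"
      unfolding p_def q_def by algebra
    then show ?thesis
      using p0 q0 by (simp add: u v field_simps)
  qed
  have uv: "u + v = 4 * s * t / (p * q)"
  proof -
    have "(s - 1 + t) * q + (1 + t - s) * p = 4 * s * t"
      unfolding p_def q_def by algebra
    then show ?thesis
      using p0 q0 by (simp add: u v field_simps)
  qed
  have u1: "1 + u = 2 * s / p"
    using p0 by (simp add: u field_simps) (simp add: p_def)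
  show "u + v \<noteq> 0" "1 + u * v \<noteq> 0" "(u + v) / (1 + u * v) = t"
    using p0 q0 assms(2,3) by (simp_all add: uv uv1)
  \<comment> \<open>The factors \<open>s\<close> and \<open>p\<close> cancel, and the conjugate
    product \<open>q\<close> then reduces the numerator to \<open>4 * y * t\<close>.\<close>
  have "(1 + u)\<^sup>2 * v / ((u + v) * (1 + u * v)) = (1 + t - s) * q / (4 * t)"
    using p0 q0 assms(2,3) unfolding u1 uv uv1 unfolding v
    by (simp add: power2_eq_square field_simps)
  then show "(1 + u)\<^sup>2 * v / ((u + v) * (1 + u * v)) = y"
    using assms(3) by (simp add: q)
qed

section \<open>Side conditions in the two fields, and both identities\<close>

lemma y_rat_plus_t_rat_nonzero: "y_rat + t_rat \<noteq> 0"
proof -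
  have "y_rat + t_rat = to_fract [:[:0, 1:], 1:]"
    by (simp add: y_rat_def t_rat_def flip: to_fract_add)
  then show ?thesis by simp
qed

lemma one_plus_y_rat_times_t_rat_nonzero: "1 + y_rat * t_rat \<noteq> 0"
proof -
  have "1 + y_rat * t_rat = to_fract [:1, [:0, 1:]:]"
    by (simp add: y_rat_def t_rat_def one_pCons flip: to_fract_add to_fract_mult to_fract_1)
  then show ?thesis by simp
qed

lemma sqrt_fls_square: "sqrt_fls\<^sup>2 = (1 + t_fls)\<^sup>2 - 4 * y_fls * t_fls"
proof -
  have "(4 :: rat poly fps) = 2 * 2" "(4 :: rat poly fract fls) = 2 * 2"
    by simp_all
  then show ?thesis
    using arg_cong[OF sqrt_fps_square, of of_series]
    by (simp only: power2_eq_square sqrt_fls_def t_fls_def y_fls_def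
        of_series_mult of_series_diff of_series_add of_series_1 of_series_2)
qed

lemma fls_nonzero:
  "sqrt_fls \<noteq> 0" "t_fls \<noteq> 0" "y_fls \<noteq> 0" "y_fls \<noteq> 1"
proof -
  have "sqrt_fps \<noteq> 0"
    using sqrt_fps_nth_0 by auto
  moreover have "y_fps \<noteq> 0" "y_fps \<noteq> 1"
    by (auto simp: y_fps_def one_pCons simp flip: fps_const_1_eq_1)
  ultimately show "sqrt_fls \<noteq> 0" "t_fls \<noteq> 0" "y_fls \<noteq> 0" "y_fls \<noteq> 1"
    unfolding sqrt_fls_def t_fls_def y_fls_def
    by (simp_all add: of_series_inject flip: of_series_0 of_series_1)
qed

theorem theorem4p10:
  fixes n :: nat
  shows "B_poly n y_rat t_rat =
      (1 + y_rat * t_rat) ^ n *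
      lpk_des_poly n
        ((1 + y_rat)\<^sup>2 * t_rat / ((y_rat + t_rat) * (1 + y_rat * t_rat)))
        ((y_rat + t_rat) / (1 + y_rat * t_rat))
    \<and> lpk_des_poly n y_fls t_fls = B_poly n u_fls v_fls / (1 + u_fls * v_fls) ^ n"
proof
  show "B_poly n y_rat t_rat =
      (1 + y_rat * t_rat) ^ n *
      lpk_des_poly n
        ((1 + y_rat)\<^sup>2 * t_rat / ((y_rat + t_rat) * (1 + y_rat * t_rat)))
        ((y_rat + t_rat) / (1 + y_rat * t_rat))"
    by (intro B_poly_eq_lpk_des_poly y_rat_plus_t_rat_nonzero one_plus_y_rat_times_t_rat_nonzero)
  note inv = inverse_substitution[OF sqrt_fls_square fls_nonzero, folded u_fls_def v_fls_def]
  show "lpk_des_poly n y_fls t_fls = B_poly n u_fls v_fls / (1 + u_fls * v_fls) ^ n"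
    \<comment> \<open>This is the first identity at \<open>u_fls\<close>, \<open>v_fls\<close>,
      where the substituted arguments collapse to \<open>y_fls\<close>, \<open>t_fls\<close>; the
      prefactor is nonzero and can be divided out.\<close>
    using B_poly_eq_lpk_des_poly[OF inv(1,2), of n] inv(2) by (simp add: inv(3,4))
qed

end
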